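(* Consider the additive Gaussian noise detection/estimation problem of the context, in its high signal-to-noise limit form. Let $x_{\mathbf m}$ be the location of the maximum and $\lambda_{\mathbf m}=\lambda(\mathbf m|x_{\mathbf m})$ the peak log-likelihood ratio. Then the Bayes decision test "choose signal at $x_{\mathbf m}$ if $T(x_{\mathbf m}|\mathbf m)>0$, choose no signal if $T(x_{\mathbf m}|\mathbf m)<0$" takes the form $$\lambda_{\mathbf m}>\lambda_r(x_{\mathbf m})\ \Rightarrow\ \text{choose signal at }x_{\mathbf m},\qquad \lambda_{\mathbf m}<\lambda_r(x_{\mathbf m})\ \Rightarrow\ \text{choose no signal},$$ where $$\lambda_r(x')=\log\left[\frac{a_0\,C(x')\,r^d(x')}{a(x')\,V(x')}\right],\qquad V(x')=\left[\det\big(Q(x')/2\pi\big)\right]^{-1/2}.$$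
   Context: Measurement model: $\mathbf m=\mathbf s(x)+\mathbf n$, where $\mathbf n$ is a Gaussian noise vector of mean zero and (positive definite) covariance $\mathbf C$. Here $\mathbf s(x)$ is a known smooth family of nonzero signals for $x$ in a $d$-dimensional continuous domain $\chi$, and $\mathbf s(x_0)=\mathbf 0$ for the no-signal state $x_0$. "No signal" has prior probability $a_0>0$, and signal parameters have prior density $a(x)>0$ on $\chi$, with $a_0+\int_\chi a=1$. The densities of $\mathbf m$ are $p_0(\mathbf m)$ (no signal) and $p_1(\mathbf m|x)$ (signal at $x$), with marginal $p(\mathbf m)=a_0p_0(\mathbf m)+\int_\chi a(x)p_1(\mathbf m|x)dx$. An asterisk denotes transpose. Amplitude SNR: $r(x)=\big(\mathbf s^*(x)\mathbf C^{-1}\mathbf s(x)\big)^{1/2}$. Likelihood ratio $L(\mathbf m|x)=p_1(\mathbf m|x)/p_0(\mathbf m)$. Log-likelihood ratio $\lambda(\mathbf m|x)=\log L(\mathbf m|x)=\mathbf s^*(x)\mathbf C^{-1}\mathbf m-\tfrac12 r^2(x)$. Normalized filter output $y(x)=\mathbf s^*(x)\mathbf C^{-1}\mathbf m/r(x)$. Curvature matrix $M_{ij}(x)=\big\langle\frac{\partial y}{\partial x_i}\frac{\partial y}{\partial x_j}\big\rangle$ (expectation with $\mathbf m=\mathbf n$), and $$Q_{ij}(x)=M_{ij}(x)+\frac{\partial\log r}{\partial x_i}\frac{\partial\log r}{\partial x_j},$$ assumed positive definite. Decision statistic: with false-alarm cost $C(x')>0$ and reward function $R(x',x)\ge0$ (cost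 of declaring a signal at $x$ absent minus cost of declaring it at $x'$), $$T(x'|\mathbf m)=\frac{p_0(\mathbf m)}{p(\mathbf m)}\left[\int_\chi R(x',x)L(\mathbf m|x)a(x)\,dx-C(x')a_0\right].$$ The location $x_{\mathbf m}$ is its maximizer over $x'$. High-SNR limit ($r^2\gg1$), standing approximations: near its maximum the likelihood ratio is the Gaussian peak $$L(\mathbf m|x)=\exp\left[\lambda_{\mathbf m}-\tfrac{r^2(x_{\mathbf m})}{2}(x-x_{\mathbf m})^*Q(x_{\mathbf m})(x-x_{\mathbf m})\right].$$ The reward function equals $1$ over the extent of the peak. The quantities $a$, $C$, $r$, $Q$ are constant over the extent of the peak. The integral over the peak region is replaced by the integral over $\mathbb R^d$. That is, in this limit $$T(x_{\mathbf m}|\mathbf m)=\frac{p_0(\mathbf m)}{p(\mathbf m)}\left[a(x_{\mathbf m})\int_{\mathbb R^d}e^{\lambda_{\mathbf m}-\frac{r^2(x_{\mathbf m})}{2}(x-x_{\mathbf m})^*Q(x_{\mathbf m})(x-x_{\mathbf m})}dx-C(x_{\mathbf m})a_0\right].$$ *)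

theory Defs
  imports "HOL-Analysis.Analysis"
begin

definition pos_def :: "real^'n^'n \<Rightarrow> bool" where
  "pos_def A \<longleftrightarrow> transpose A = A \<and> (\<forall>v. v \<noteq> 0 \<longrightarrow> v \<bullet> (A *v v) > 0)"

definition partial :: "'d::finite \<Rightarrow> (real^'d \<Rightarrow> 'b::real_normed_vector) \<Rightarrow> real^'d \<Rightarrow> 'b" where
  "partial i f x = frechet_derivative f (at x) (axis i 1)"

text \<open>
  On an open set, \<open>C_k_on k f S\<close> says that \<open>f\<close> is \<open>k\<close> times continuously differentiable.
\<close>
fun C_k_on :: "nat \<Rightarrow> (real^'d::finite \<Rightarrow> 'b::real_normed_vector) \<Rightarrow> (real^'d) set \<Rightarrow> bool" where
  "C_k_on 0 f S \<longleftrightarrow> continuous_on S f"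
| "C_k_on (Suc k) f S \<longleftrightarrow>
     (\<forall>x\<in>S. f differentiable (at x)) \<and> (\<forall>i. C_k_on k (partial i f) S)"

definition smooth_on :: "(real^'d::finite \<Rightarrow> 'b::real_normed_vector) \<Rightarrow> (real^'d) set \<Rightarrow> bool" where
  "smooth_on f S \<longleftrightarrow> (\<forall>k. C_k_on k f S)"

text \<open>
  Throughout, \<open>C\<close> is the noise covariance, \<open>s\<close> the signal family on the parameter domain \<open>X\<close>,
  \<open>a0\<close> and \<open>a\<close> the prior probability of no signal and the prior density of the signal
  parameters, \<open>cost\<close> the false-alarm cost and \<open>R\<close> the reward function.
  The no-signal state is not a point of \<open>X\<close>; as its signal is the zero vector, it enters
  through the density \<open>gauss_density C 0\<close> of a measurement that contains only noise.
\<close>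

definition gauss_density :: "real^'n^'n \<Rightarrow> real^'n \<Rightarrow> real^'n \<Rightarrow> real" where
  "gauss_density C \<mu> m =
     exp (- (1/2) * ((m - \<mu>) \<bullet> (matrix_inv C *v (m - \<mu>)))) / sqrt (det ((2 * pi) *\<^sub>R C))"

definition p0 :: "real^'n^'n \<Rightarrow> real^'n \<Rightarrow> real" where
  "p0 C m = gauss_density C 0 m"

definition p1 :: "real^'n^'n \<Rightarrow> (real^'d \<Rightarrow> real^'n) \<Rightarrow> real^'n \<Rightarrow> real^'d \<Rightarrow> real" where
  "p1 C s m x = gauss_density C (s x) m"

definition marginal ::
  "real^'n^'n \<Rightarrow> (real^'d \<Rightarrow> real^'n) \<Rightarrow> (real^'d) set \<Rightarrow> real \<Rightarrow> (real^'d \<Rightarrow> real) \<Rightarrow> real^'n \<Rightarrow> real"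
where
  "marginal C s X a0 a m = a0 * p0 C m + (LINT x:X|lborel. a x * p1 C s m x)"

definition noise :: "real^'n^'n \<Rightarrow> (real^'n) measure" where
  "noise C = density lborel (\<lambda>n. ennreal (p0 C n))"

definition snr :: "real^'n^'n \<Rightarrow> (real^'d \<Rightarrow> real^'n) \<Rightarrow> real^'d \<Rightarrow> real" where
  "snr C s x = sqrt (s x \<bullet> (matrix_inv C *v s x))"

definition likelihood_ratio ::
  "real^'n^'n \<Rightarrow> (real^'d \<Rightarrow> real^'n) \<Rightarrow> real^'n \<Rightarrow> real^'d \<Rightarrow> real" where
  "likelihood_ratio C s m x = p1 C s m x / p0 C m"

definition log_lr :: "real^'n^'n \<Rightarrow> (real^'d \<Rightarrow> real^'n) \<Rightarrow> real^'n \<Rightarrow> real^'d \<Rightarrow> real" where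
  "log_lr C s m x = ln (likelihood_ratio C s m x)"

definition filter_output ::
  "real^'n^'n \<Rightarrow> (real^'d \<Rightarrow> real^'n) \<Rightarrow> real^'n \<Rightarrow> real^'d \<Rightarrow> real" where
  "filter_output C s m x = (s x \<bullet> (matrix_inv C *v m)) / snr C s x"

definition curvature :: "real^'n^'n \<Rightarrow> (real^'d \<Rightarrow> real^'n) \<Rightarrow> real^'d \<Rightarrow> real^'d^'d" where
  "curvature C s x =
     (\<chi> i j. LINT n|noise C. partial i (filter_output C s n) x * partial j (filter_output C s n) x)"

definition Q_matrix :: "real^'n^'n \<Rightarrow> (real^'d \<Rightarrow> real^'n) \<Rightarrow> real^'d \<Rightarrow> real^'d^'d" where
  "Q_matrix C s x =
     (\<chi> i j. curvature C s x $ i $ j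
             + partial i (\<lambda>z. ln (snr C s z)) x * partial j (\<lambda>z. ln (snr C s z)) x)"

definition decision_statistic ::
  "real^'n^'n \<Rightarrow> (real^'d \<Rightarrow> real^'n) \<Rightarrow> (real^'d) set \<Rightarrow> real \<Rightarrow> (real^'d \<Rightarrow> real)
   \<Rightarrow> (real^'d \<Rightarrow> real) \<Rightarrow> (real^'d \<Rightarrow> real^'d \<Rightarrow> real) \<Rightarrow> real^'n \<Rightarrow> real^'d \<Rightarrow> real"
where
  "decision_statistic C s X a0 a cost R m x' =
     p0 C m / marginal C s X a0 a m *
     ((LINT x:X|lborel. R x' x * likelihood_ratio C s m x * a x) - cost x' * a0)"

datatype 'x decision = Signal_At 'x | No_Signal

text \<open>The test prescribes nothing when the statistic vanishes.\<close>
definition bayes_test ::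
  "real^'n^'n \<Rightarrow> (real^'d \<Rightarrow> real^'n) \<Rightarrow> (real^'d) set \<Rightarrow> real \<Rightarrow> (real^'d \<Rightarrow> real)
   \<Rightarrow> (real^'d \<Rightarrow> real) \<Rightarrow> (real^'d \<Rightarrow> real^'d \<Rightarrow> real) \<Rightarrow> real^'n \<Rightarrow> real^'d
   \<Rightarrow> (real^'d) decision option"
where
  "bayes_test C s X a0 a cost R m xm =
     (if decision_statistic C s X a0 a cost R m xm > 0 then Some (Signal_At xm)
      else if decision_statistic C s X a0 a cost R m xm < 0 then Some No_Signal
      else None)"

definition peak_volume :: "real^'n^'n \<Rightarrow> (real^'d \<Rightarrow> real^'n) \<Rightarrow> real^'d \<Rightarrow> real" where
  "peak_volume C s x' = det ((1 / (2 * pi)) *\<^sub>R Q_matrix C s x') powr (- 1/2)"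

definition threshold ::
  "real^'n^'n \<Rightarrow> (real^'d \<Rightarrow> real^'n) \<Rightarrow> real \<Rightarrow> (real^'d \<Rightarrow> real) \<Rightarrow> (real^'d \<Rightarrow> real)
   \<Rightarrow> real^'d \<Rightarrow> real"
where
  "threshold C s a0 a cost x' =
     ln (a0 * cost x' * snr C s x' ^ CARD('d) / (a x' * peak_volume C s x'))"

text \<open>Agreement with the closed form of the log-likelihood ratio.\<close>
lemma log_lr_eq:
  assumes C: "pos_def C"
  shows "log_lr C s m x = s x \<bullet> (matrix_inv C *v m) - (1/2) * (snr C s x)\<^sup>2"
proof -
  have sym: "transpose C = C" and pd: "\<And>v. v \<noteq> 0 \<Longrightarrow> v \<bullet> (C *v v) > 0"
    using C by (auto simp: pos_def_def)
  have invC: "invertible C"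
    using pd by (metis invertible_left_inverse matrix_left_invertible_ker inner_zero_right less_irrefl)
  then have inv: "C ** matrix_inv C = mat 1 \<and> matrix_inv C ** C = mat 1"
    unfolding invertible_def matrix_inv_def by (rule someI_ex)
  define D where "D = matrix_inv C"
  have CD: "C ** D = mat 1" and DC: "D ** C = mat 1" using inv by (auto simp: D_def)
  have symD: "u \<bullet> (D *v v) = v \<bullet> (D *v u)" for u v
  proof -
    have "u \<bullet> (D *v v) = (C *v (D *v u)) \<bullet> (D *v v)"
      by (simp add: matrix_vector_mul_assoc CD)
    also have "\<dots> = (D *v u) \<bullet> (C *v (D *v v))"
      by (metis dot_lmul_matrix sym transpose_matrix_vector)
    finally show ?thesis by (simp add: matrix_vector_mul_assoc CD inner_commute)
  qed
  have nonneg: "v \<bullet> (D *v v) \<ge> 0" for v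
  proof -
    have "v \<bullet> (D *v v) = (C *v (D *v v)) \<bullet> (D *v v)"
      by (simp add: matrix_vector_mul_assoc CD)
    then show ?thesis
      using pd[of "D *v v"] by (cases "D *v v = 0") (auto simp: inner_commute)
  qed
  have det_ne: "det ((2 * pi) *\<^sub>R C) \<noteq> 0"
    using scalar_invertible[OF _ invC, of "2 * pi"] by (simp add: invertible_det_nz)
  have "likelihood_ratio C s m x =
          exp (- (1/2) * ((m - s x) \<bullet> (D *v (m - s x))) + (1/2) * (m \<bullet> (D *v m)))"
    using det_ne
    by (simp add: likelihood_ratio_def p1_def p0_def gauss_density_def D_def flip: exp_diff)
  also have "- (1/2) * ((m - s x) \<bullet> (D *v (m - s x))) + (1/2) * (m \<bullet> (D *v m))
             = s x \<bullet> (D *v m) - (1/2) * (s x \<bullet> (D *v s x))"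
    using symD[of m "s x"]
    by (simp add: matrix_vector_mult_diff_distrib inner_diff_left inner_diff_right algebra_simps)
  finally show ?thesis
    using nonneg[of "s x"] by (simp add: log_lr_def snr_def D_def)
qed

end

theory Submission
  imports Defs "HOL-Probability.Distributions"
begin

text \<open>
  In the high signal-to-noise form of the decision statistic the reward integral has become the
  integral of a Gaussian peak of height \<open>exp \<lambda>\<close> and precision matrix \<open>r\<^sup>2 Q\<close>. Its value is
  \<open>exp \<lambda> \<cdot> V / r\<^sup>d\<close> (\<open>likelihood_peak_integral\<close>), because scaling a \<open>d\<close>-dimensional quadratic form
  by \<open>r\<^sup>2\<close> multiplies its determinant by \<open>r ^ (2 * d)\<close>. Hence the statistic is
  a positive multiple of \<open>a V exp \<lambda> / r\<^sup>d - cost a0\<close>, whose sign is that of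
  \<open>\<lambda> - ln (a0 cost r\<^sup>d / (a V))\<close>. What is subtracted from \<open>\<lambda>\<close> is the threshold, so the two
  tests agree, including the case of equality. That the multiple is positive needs the Gaussian
  densities and the marginal density to be positive.

  The analytic content is the Gaussian integral for an arbitrary positive definite matrix
  (\<open>gaussian_integral\<close>). It is computed by completing the square in one coordinate after
  another. Each such step is a shear of the integration variable: Lebesgue measure does not
  change, by Fubini and translation invariance on the line (\<open>nn_integral_lborel_shear\<close>), and
  neither does the determinant of the quadratic form, as the shear matrix has determinant one. In
  the end the form is diagonal, and the integral is a product of one-dimensional ones. The same
  elimination shows that a positive definite matrix has positive determinant.
\<close>

section \<open>Shears\<close>

text \<open>
  Along the direction of \<open>b\<close> the shear is a translation, by an amount that depends only on the other
  coordinates since \<open>c\<close> is orthogonal to \<open>b\<close>. Integrating over the \<open>b\<close>-coordinate first removes it.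
\<close>

lemma nn_integral_lborel_shear:
  fixes f :: "'a::euclidean_space \<Rightarrow> ennreal" and b c :: 'a
  assumes b: "b \<in> Basis" and cb: "c \<bullet> b = 0" and f[measurable]: "f \<in> borel_measurable borel"
  shows "(\<integral>\<^sup>+x. f (x + (c \<bullet> x) *\<^sub>R b) \<partial>lborel) = (\<integral>\<^sup>+x. f x \<partial>lborel)"
proof -
  interpret product_sigma_finite "\<lambda>_::'a. lborel :: real measure" by standard
  define I where "I = (Basis :: 'a set) - {b}"
  have I: "finite I" "b \<notin> I" "insert b I = Basis" using b by (auto simp: I_def)
  define S where "S x = (\<Sum>i\<in>I. x i *\<^sub>R i)" for x :: "'a \<Rightarrow> real"
  have fubini: "(\<integral>\<^sup>+x. g x \<partial>lborel) = (\<integral>\<^sup>+x. (\<integral>\<^sup>+y. g (S x + y *\<^sub>R b) \<partial>lborel) \<partial>Pi\<^sub>M I (\<lambda>_. lborel))"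
    if g[measurable]: "g \<in> borel_measurable borel" for g :: "'a \<Rightarrow> ennreal"
  proof -
    have "(\<integral>\<^sup>+x. g x \<partial>lborel) = (\<integral>\<^sup>+x. g (\<Sum>i\<in>Basis. x i *\<^sub>R i) \<partial>Pi\<^sub>M Basis (\<lambda>_. lborel))"
      by (subst lborel_eq) (simp add: nn_integral_distr)
    also have "\<dots> = (\<integral>\<^sup>+x. g (\<Sum>i\<in>insert b I. x i *\<^sub>R i) \<partial>Pi\<^sub>M (insert b I) (\<lambda>_. lborel))"
      by (simp add: I)
    also have "\<dots> = (\<integral>\<^sup>+x. (\<integral>\<^sup>+y. g (\<Sum>i\<in>insert b I. (x(b := y)) i *\<^sub>R i) \<partial>lborel) \<partial>Pi\<^sub>M I (\<lambda>_. lborel))"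
      by (rule product_nn_integral_insert) (use I in \<open>simp_all\<close>)
    also have "\<dots> = (\<integral>\<^sup>+x. (\<integral>\<^sup>+y. g (S x + y *\<^sub>R b) \<partial>lborel) \<partial>Pi\<^sub>M I (\<lambda>_. lborel))"
    proof -
      have "(\<Sum>i\<in>insert b I. (x(b := y)) i *\<^sub>R i) = S x + y *\<^sub>R b" for x y
      proof -
        have "(\<Sum>i\<in>I. (x(b := y)) i *\<^sub>R i) = S x"
          unfolding S_def using I(2) by (intro sum.cong) auto
        then show ?thesis using I(1,2) by (simp add: add.commute)
      qed
      then show ?thesis by simp
    qed
    finally show ?thesis .
  qed
  \<comment> \<open>The factor \<open>1\<close> puts the translation into the form of an affine substitution on the line.\<close>
  have "(\<integral>\<^sup>+x. f (x + (c \<bullet> x) *\<^sub>R b) \<partial>lborel)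
      = (\<integral>\<^sup>+x. (\<integral>\<^sup>+y. f (S x + (c \<bullet> S x + 1 * y) *\<^sub>R b) \<partial>lborel) \<partial>Pi\<^sub>M I (\<lambda>_. lborel))"
    by (subst fubini) (simp_all add: cb inner_add_right algebra_simps)
  also have "\<dots> = (\<integral>\<^sup>+x. (\<integral>\<^sup>+y. f (S x + y *\<^sub>R b) \<partial>lborel) \<partial>Pi\<^sub>M I (\<lambda>_. lborel))"
    by (rule nn_integral_cong, subst nn_integral_real_affine[where c = 1]) simp_all
  also have "\<dots> = (\<integral>\<^sup>+x. f x \<partial>lborel)"
    by (rule fubini[symmetric]) measurable
  finally show ?thesis .
qed

text \<open>
  A shear in the strict sense, with determinant one, only when \<open>c $ k = 0\<close>; in general the
  determinant is \<open>1 + c $ k\<close>.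
\<close>

definition shear_matrix :: "'n \<Rightarrow> real^'n \<Rightarrow> real^'n^'n" where
  "shear_matrix k c = (\<chi> i. if i = k then axis k 1 + c else axis i 1)"

lemma shear_matrix_mult_vec: "shear_matrix k c *v v = v + (c \<bullet> v) *\<^sub>R axis k 1"
proof -
  have "axis i 1 \<bullet> v = v $ i" for i
    by (simp add: inner_axis')
  then show ?thesis
    by (auto simp: vec_eq_iff shear_matrix_def matrix_vector_mul_component inner_add_left)
      (simp_all add: axis_def)
qed

lemma det_shear_matrix:
  fixes c :: "real^'n"
  assumes "c $ k = 0"
  shows "det (shear_matrix k c) = 1"
proof -
  have row: "row i (mat 1 :: real^'n^'n) = axis i 1" for i
    by (simp add: vec_eq_iff row_def mat_def axis_def)
  have "c = (\<Sum>j\<in>UNIV. c $ j *s axis j 1)"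
    by (simp add: basis_expansion)
  also have "\<dots> \<in> vec.span {row j (mat 1 :: real^'n^'n) |j. j \<noteq> k}"
  proof (rule vec.span_sum)
    fix j show "c $ j *s axis j 1 \<in> vec.span {row j (mat 1 :: real^'n^'n) |j. j \<noteq> k}"
    proof (cases "j = k")
      case True then show ?thesis by (simp add: assms vec.span_zero)
    next
      case False then show ?thesis by (intro vec.span_scale vec.span_base) (auto simp: row)
    qed
  qed
  finally show ?thesis
    using det_row_span[of c "mat 1" k] by (simp add: row shear_matrix_def cong: if_cong)
qed

section \<open>Gaussian integrals\<close>

text \<open>
  The substitution of \<open>E *v x\<close> for \<open>x\<close> in the bilinear form of \<open>A\<close> is expressed by the congruent
  matrix. This links changes of the integration variable with changes of the matrix.
\<close>

lemma quadratic_form_congruence: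
  fixes A E :: "real^'n^'n"
  shows "u \<bullet> ((transpose E ** A ** E) *v v) = (E *v u) \<bullet> (A *v (E *v v))"
proof -
  have "u \<bullet> (transpose E *v w) = (E *v u) \<bullet> w" for w
    by (simp add: transpose_matrix_vector dot_lmul_matrix inner_commute[of _ w] inner_commute[of u])
  then show ?thesis by (simp flip: matrix_vector_mul_assoc)
qed

lemma matrix_entry_quadratic: "(A :: real^'n^'n) $ i $ j = axis i 1 \<bullet> (A *v axis j 1)"
  by (simp add: inner_axis' matrix_vector_mul_component inner_axis)

lemma pos_def_congruence:
  fixes A E :: "real^'n^'n"
  assumes "pos_def A" and "invertible E"
  shows "pos_def (transpose E ** A ** E)"
proof -
  have "E *v v \<noteq> 0" if "v \<noteq> 0" for v
  proof
    assume "E *v v = 0"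
    moreover obtain E' where "E' ** E = mat 1" using assms(2) by (auto simp: invertible_def)
    ultimately have "v = 0" by (metis matrix_left_invertible_ker)
    with that show False ..
  qed
  moreover have "transpose (transpose E ** A ** E) = transpose E ** A ** E"
    using assms(1) by (simp add: pos_def_def matrix_transpose_mul matrix_mul_assoc)
  ultimately show ?thesis
    using assms(1) by (simp add: pos_def_def quadratic_form_congruence)
qed

text \<open>
  The integrand is a multiple of the normal density with variance \<open>1 / \<alpha>\<close>, which has total mass one.
\<close>

lemma nn_integral_gaussian_real:
  assumes "\<alpha> > 0"
  shows "(\<integral>\<^sup>+x. ennreal (exp (- (\<alpha> * x\<^sup>2 / 2))) \<partial>lborel) = ennreal (sqrt (2 * pi / \<alpha>))"
proof -
  let ?\<sigma> = "1 / sqrt \<alpha>"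
  have "ennreal (exp (- (\<alpha> * x\<^sup>2 / 2))) = ennreal (sqrt (2 * pi / \<alpha>)) * ennreal (normal_density 0 ?\<sigma> x)" for x
    using assms
    by (simp add: normal_density_def power_divide real_sqrt_divide real_sqrt_mult field_simps
        flip: ennreal_mult)
  then have "(\<integral>\<^sup>+x. ennreal (exp (- (\<alpha> * x\<^sup>2 / 2))) \<partial>lborel)
      = ennreal (sqrt (2 * pi / \<alpha>)) * (\<integral>\<^sup>+x. ennreal (normal_density 0 ?\<sigma> x) \<partial>lborel)"
    by (simp add: nn_integral_cmult)
  also have "(\<integral>\<^sup>+x. ennreal (normal_density 0 ?\<sigma> x) \<partial>lborel) = 1"
    using assms by (subst nn_integral_eq_integral) simp_all
  finally show ?thesis by simp
qed

lemma pos_def_diag_pos: "pos_def A \<Longrightarrow> A $ i $ i > 0"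
  by (simp add: pos_def_def matrix_entry_quadratic axis_eq_0_iff)

lemma nn_integral_gaussian_diagonal:
  fixes A :: "real^'n^'n"
  assumes pos: "\<And>i. A $ i $ i > 0" and diag: "\<And>i j. i \<noteq> j \<Longrightarrow> A $ i $ j = 0"
  shows "(\<integral>\<^sup>+x. ennreal (exp (- (x \<bullet> (A *v x) / 2))) \<partial>lborel)
    = ennreal (sqrt ((2 * pi) ^ CARD('n) / det A))"
proof -
  \<comment> \<open>The product rule for Lebesgue measure ranges over basis vectors, so the one-dimensional factors
    are indexed by these; at \<open>axis i 1\<close> the coefficient is the diagonal entry.\<close>
  define g where "g b y = exp (- ((b \<bullet> (A *v b)) * y\<^sup>2 / 2))" for b :: "real^'n" and y :: real
  have inj: "inj (\<lambda>i::'n. axis i (1::real))" by (auto simp: inj_on_def axis_eq_axis)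
  have Basis: "(Basis :: (real^'n) set) = range (\<lambda>i. axis i 1)" by (auto simp: Basis_vec_def)
  have g_axis: "g (axis i 1) y = exp (- (A $ i $ i * y\<^sup>2 / 2))" for i y
    by (simp add: g_def flip: matrix_entry_quadratic)
  have Ax: "(A *v x) $ i = A $ i $ i * x $ i" for x i
  proof -
    have "(A *v x) $ i = (\<Sum>j\<in>UNIV. if j = i then A $ i $ i * x $ i else 0)"
      unfolding matrix_vector_mult_def vec_lambda_beta
      by (rule sum.cong) (use diag[of i] in auto)
    then show ?thesis by simp
  qed
  have "exp (- (x \<bullet> (A *v x) / 2)) = (\<Prod>b\<in>Basis. g b (x \<bullet> b))" for x
  proof -
    have "(\<Prod>b\<in>Basis. g b (x \<bullet> b)) = (\<Prod>i\<in>UNIV. exp (- (A $ i $ i * (x $ i)\<^sup>2 / 2)))"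
      unfolding Basis by (simp add: prod.reindex[OF inj] g_axis inner_axis)
    also have "\<dots> = exp (\<Sum>i\<in>UNIV. - (A $ i $ i * (x $ i)\<^sup>2 / 2))"
      by (simp add: exp_sum)
    also have "(\<Sum>i\<in>UNIV. - (A $ i $ i * (x $ i)\<^sup>2 / 2)) = - (x \<bullet> (A *v x) / 2)"
      by (simp add: inner_vec_def Ax sum_negf sum_divide_distrib power2_eq_square ac_simps)
    finally show ?thesis by simp
  qed
  then have "(\<integral>\<^sup>+x. ennreal (exp (- (x \<bullet> (A *v x) / 2))) \<partial>lborel)
      = (\<integral>\<^sup>+x. (\<Prod>b\<in>Basis. ennreal (g b (x \<bullet> b))) \<partial>lborel)"
    by (simp add: prod_ennreal g_def)
  also have "\<dots> = (\<Prod>b\<in>Basis. \<integral>\<^sup>+y. ennreal (g b y) \<partial>lborel)"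
    by (rule nn_integral_lborel_prod) (auto simp: g_def)
  also have "\<dots> = (\<Prod>i\<in>UNIV. ennreal (sqrt (2 * pi / A $ i $ i)))"
    unfolding Basis by (simp add: prod.reindex[OF inj] g_axis nn_integral_gaussian_real pos)
  also have "\<dots> = ennreal (\<Prod>i\<in>UNIV. sqrt (2 * pi / A $ i $ i))"
    using pos by (intro prod_ennreal) (simp add: less_imp_le)
  also have "(\<Prod>i\<in>UNIV. sqrt (2 * pi / A $ i $ i)) = sqrt (\<Prod>i\<in>UNIV. 2 * pi / A $ i $ i)"
    by (induction rule: infinite_finite_induct) (simp_all flip: real_sqrt_mult)
  also have "(\<Prod>i\<in>UNIV. 2 * pi / A $ i $ i) = (2 * pi) ^ CARD('n) / det A"
    by (simp add: prod_dividef det_diagonal diag)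
  finally show ?thesis .
qed

text \<open>
  Induction on a set \<open>S\<close> of coordinates that may still be coupled to one another, every
  coordinate outside \<open>S\<close> being decoupled from all others. Completing the square in \<open>x\<^sub>k\<close> decouples the
  coordinate \<open>k\<close> and leaves the coordinates outside \<open>S\<close> decoupled, while the determinant and the
  integral keep their values. Positivity of the determinant is proved along with the integral,
  as both are immediate once the matrix is diagonal.
\<close>

lemma gaussian_integral_by_completing_squares:
  fixes A :: "real^'n^'n"
  assumes "finite S" and "pos_def A"
    and "\<And>i j. i \<noteq> j \<Longrightarrow> A $ i $ j \<noteq> 0 \<Longrightarrow> i \<in> S \<and> j \<in> S"
  shows "det A > 0 \<and> (\<integral>\<^sup>+x. ennreal (exp (- (x \<bullet> (A *v x) / 2))) \<partial>lborel)
    = ennreal (sqrt ((2 * pi) ^ CARD('n) / det A))"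
  using assms
proof (induction S arbitrary: A rule: finite_induct)
  case empty
  have pos: "A $ i $ i > 0" for i using empty by (simp add: pos_def_diag_pos)
  have diag: "A $ i $ j = 0" if "i \<noteq> j" for i j using empty that by blast
  have "det A > 0" using pos by (simp add: det_diagonal diag prod_pos)
  then show ?case using nn_integral_gaussian_diagonal[of A] pos diag by blast
next
  case (insert k S)
  have pos: "A $ k $ k > 0" using insert.prems(1) by (rule pos_def_diag_pos)
  have sym: "A $ i $ j = A $ j $ i" for i j
  proof -
    have "transpose A $ i $ j = A $ i $ j" using insert.prems(1) by (simp add: pos_def_def)
    then show ?thesis by (simp add: transpose_def)
  qed
  \<comment> \<open>The square in \<open>x\<^sub>k\<close> is \<open>A\<^sub>k\<^sub>k (x\<^sub>k + (\<Sum>j\<noteq>k. A\<^sub>k\<^sub>j x\<^sub>j) / A\<^sub>k\<^sub>k)\<^sup>2\<close>; substituting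
    \<open>x\<^sub>k + c \<bullet> x\<close> for \<open>x\<^sub>k\<close> cancels the cross terms.\<close>
  define c where "c = (\<chi> j. if j = k then 0 else - A $ k $ j / A $ k $ k)"
  define E where "E = shear_matrix k c"
  define B where "B = transpose E ** A ** E"
  have ck: "c $ k = 0" by (simp add: c_def)
  have detE: "det E = 1" using ck by (simp add: E_def det_shear_matrix)
  have E_axis: "E *v axis j 1 = axis j 1 + c $ j *\<^sub>R axis k 1" for j
    by (simp add: E_def shear_matrix_mult_vec inner_axis)
  have B_entry: "B $ i $ j = A $ i $ j + c $ j * A $ i $ k + c $ i * A $ k $ j + c $ i * c $ j * A $ k $ k"
    for i j
  proof -
    have "B $ i $ j = axis i 1 \<bullet> (B *v axis j 1)" by (rule matrix_entry_quadratic)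
    also have "\<dots> = (E *v axis i 1) \<bullet> (A *v (E *v axis j 1))"
      unfolding B_def by (rule quadratic_form_congruence)
    also have "\<dots> = A $ i $ j + c $ j * A $ i $ k + c $ i * A $ k $ j + c $ i * c $ j * A $ k $ k"
      unfolding E_axis
      by (simp add: matrix_vector_right_distrib inner_add_left inner_add_right
          matrix_vector_mult_scaleR algebra_simps flip: matrix_entry_quadratic)
    finally show ?thesis .
  qed
  have "pos_def B" unfolding B_def
    by (rule pos_def_congruence[OF insert.prems(1)]) (simp add: invertible_det_nz detE)
  moreover have "i \<in> S \<and> j \<in> S" if ij: "i \<noteq> j" and nz: "B $ i $ j \<noteq> 0" for i j
  proof -
    have ne: "i \<noteq> k" "j \<noteq> k"
      using ij nz pos sym by (auto simp: B_entry c_def)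
    \<comment> \<open>The new block is the Schur complement; it couples only pairs that were coupled before, either
      to each other or both to \<open>k\<close>.\<close>
    have "B $ i $ j = A $ i $ j - A $ i $ k * A $ k $ j / A $ k $ k"
      using ne pos sym[of k i] by (simp add: B_entry c_def)
    with nz have "A $ i $ j \<noteq> 0 \<or> A $ i $ k \<noteq> 0 \<and> A $ k $ j \<noteq> 0" by auto
    then show ?thesis
      using insert.prems(2)[of i j] insert.prems(2)[of i k] insert.prems(2)[of k j] ij ne by auto
  qed
  ultimately have IH: "det B > 0 \<and> (\<integral>\<^sup>+x. ennreal (exp (- (x \<bullet> (B *v x) / 2))) \<partial>lborel)
    = ennreal (sqrt ((2 * pi) ^ CARD('n) / det B))"
    by (rule insert.IH)
  have "(\<integral>\<^sup>+x. ennreal (exp (- (x \<bullet> (B *v x) / 2))) \<partial>lborel)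
      = (\<integral>\<^sup>+x. (\<lambda>x. ennreal (exp (- (x \<bullet> (A *v x) / 2)))) (x + (c \<bullet> x) *\<^sub>R axis k 1) \<partial>lborel)"
    by (simp add: B_def quadratic_form_congruence E_def shear_matrix_mult_vec)
  also have "\<dots> = (\<integral>\<^sup>+x. ennreal (exp (- (x \<bullet> (A *v x) / 2))) \<partial>lborel)"
    by (rule nn_integral_lborel_shear)
      (auto simp: inner_axis ck intro!: borel_measurable_continuous_onI continuous_intros
        matrix_vector_mult_linear_continuous_on measurable_compose[OF _ measurable_ennreal])
  finally show ?case
    using IH by (simp add: B_def det_mul detE)
qed

lemma pos_def_det_pos:
  assumes "pos_def A" shows "det A > 0"
  using gaussian_integral_by_completing_squares[of UNIV A] assms by simp

lemma det_scaleR: "det (c *\<^sub>R A) = c ^ CARD('n) * det A" for A :: "real^'n^'n"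
proof -
  have "c *\<^sub>R A = matrix ((*\<^sub>R) c) ** A"
    by (simp add: matrix_eq matrix_vector_mul_assoc[symmetric] matrix_works scaleR_matrix_vector_assoc)
  then show ?thesis by (simp add: det_mul)
qed

lemma pos_def_scaleR: "pos_def A \<Longrightarrow> c > 0 \<Longrightarrow> pos_def (c *\<^sub>R A)"
  by (auto simp: pos_def_def transpose_def vec_eq_iff simp flip: scaleR_matrix_vector_assoc)

text \<open>
  Translation reduces the integral to mean zero. The power of \<open>2 \<pi>\<close> is kept inside the determinant,
  so that the right-hand side at the \<open>Q\<close> matrix is the peak volume.
\<close>

lemma gaussian_integral:
  fixes A :: "real^'n^'n"
  assumes A: "pos_def A"
  shows "(LINT x|lborel. exp (- ((x - \<mu>) \<bullet> (A *v (x - \<mu>)) / 2)))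
    = det ((1 / (2 * pi)) *\<^sub>R A) powr (- 1/2)"
proof -
  let ?f = "\<lambda>x. exp (- (x \<bullet> (A *v x) / 2))"
  have f[measurable]: "?f \<in> borel_measurable borel"
    by (intro borel_measurable_continuous_onI continuous_intros
        matrix_vector_mult_linear_continuous_on) simp_all
  have "(LINT x|lborel. ?f (x - \<mu>)) = (LINT x|distr lborel borel ((+) (- \<mu>)). ?f x)"
    by (subst integral_distr) simp_all
  also have "\<dots> = (LINT x|lborel. ?f x)"
    by (simp add: lborel_distr_plus)
  also have "\<dots> = enn2real (\<integral>\<^sup>+x. ennreal (?f x) \<partial>lborel)"
    by (rule integral_eq_nn_integral) simp_all
  also have "\<dots> = sqrt ((2 * pi) ^ CARD('n) / det A)"
    using gaussian_integral_by_completing_squares[of UNIV A] A by simp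
  also have "\<dots> = inverse (sqrt (det ((1 / (2 * pi)) *\<^sub>R A)))"
    by (simp add: det_scaleR power_divide real_sqrt_divide)
  also have "\<dots> = det ((1 / (2 * pi)) *\<^sub>R A) powr (- 1/2)"
    using pos_def_det_pos[OF pos_def_scaleR[OF A, of "1 / (2 * pi)"]]
    by (simp add: powr_minus powr_half_sqrt)
  finally show ?thesis .
qed

section \<open>The detection test\<close>

text \<open>
  With \<open>v = C *v u\<close> the form of the inverse matrix at \<open>v\<close> is the form of \<open>C\<close> itself at \<open>u\<close>. It makes
  the signal-to-noise ratio of a nonzero signal positive.
\<close>

lemma pos_def_matrix_inv_quadratic:
  assumes C: "pos_def C" and "v \<noteq> 0"
  shows "v \<bullet> (matrix_inv C *v v) > 0"
proof -
  have inv: "C ** matrix_inv C = mat 1"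
  proof -
    have "invertible C" using pos_def_det_pos[OF C] by (simp add: invertible_det_nz)
    then have "C ** matrix_inv C = mat 1 \<and> matrix_inv C ** C = mat 1"
      unfolding invertible_def matrix_inv_def by (rule someI_ex)
    then show ?thesis by simp
  qed
  define u where "u = matrix_inv C *v v"
  have v: "v = C *v u" by (simp add: u_def matrix_vector_mul_assoc inv)
  with \<open>v \<noteq> 0\<close> have "u \<noteq> 0" by auto
  then have "u \<bullet> (C *v u) > 0" using C by (simp add: pos_def_def)
  then show ?thesis unfolding u_def[symmetric] v[symmetric] by (simp add: inner_commute)
qed

lemma snr_pos: "pos_def C \<Longrightarrow> s x \<noteq> 0 \<Longrightarrow> snr C s x > 0"
  by (simp add: snr_def pos_def_matrix_inv_quadratic)

lemma gauss_density_pos: "pos_def C \<Longrightarrow> gauss_density C \<mu> m > 0"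
  by (simp add: gauss_density_def pos_def_det_pos pos_def_scaleR)

lemma marginal_pos:
  assumes "pos_def C" and "a0 > 0" and "\<And>x. x \<in> X \<Longrightarrow> a x \<ge> 0"
  shows "marginal C s X a0 a m > 0"
proof -
  have "(LINT x:X|lborel. a x * p1 C s m x) \<ge> 0"
    unfolding set_lebesgue_integral_def
    using assms(3) gauss_density_pos[OF assms(1)]
    by (intro Bochner_Integration.integral_nonneg) (auto simp: indicator_def p1_def less_imp_le)
  moreover have "a0 * p0 C m > 0"
    using assms(2) gauss_density_pos[OF assms(1)] by (simp add: p0_def)
  ultimately show ?thesis by (simp add: marginal_def)
qed

lemma peak_volume_pos: "pos_def (Q_matrix C s x) \<Longrightarrow> peak_volume C s x > 0"
  using pos_def_det_pos[OF pos_def_scaleR, of "Q_matrix C s x" "1 / (2 * pi)"]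
  by (simp add: peak_volume_def)

text \<open>
  The volume under the Gaussian peak of the likelihood ratio. A single length scale contracts
  like \<open>1 / r\<close>, which in \<open>d\<close> dimensions gives the power of the signal-to-noise ratio that
  appears in the threshold.
\<close>

lemma likelihood_peak_integral:
  fixes s :: "real^'d \<Rightarrow> real^'n"
  assumes Q: "pos_def (Q_matrix C s xm)" and r: "snr C s xm > 0"
  shows "(LINT x|lborel. exp (l - (snr C s xm)\<^sup>2 / 2 * ((x - xm) \<bullet> (Q_matrix C s xm *v (x - xm)))))
    = exp l * peak_volume C s xm / snr C s xm ^ CARD('d)"
proof -
  let ?r = "snr C s xm" and ?Q = "Q_matrix C s xm"
  define D where "D = det ((1 / (2 * pi)) *\<^sub>R ?Q)"
  have D: "D > 0" unfolding D_def by (intro pos_def_det_pos pos_def_scaleR Q) simp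
  have "(LINT x|lborel. exp (l - ?r\<^sup>2 / 2 * ((x - xm) \<bullet> (?Q *v (x - xm)))))
      = (LINT x|lborel. exp l * exp (- ((x - xm) \<bullet> ((?r\<^sup>2 *\<^sub>R ?Q) *v (x - xm)) / 2)))"
  proof -
    have "exp (l - ?r\<^sup>2 / 2 * q) = exp l * exp (- (?r\<^sup>2 * q / 2))" for q
      by (simp flip: exp_add)
    moreover have "v \<bullet> ((?r\<^sup>2 *\<^sub>R ?Q) *v v) = ?r\<^sup>2 * (v \<bullet> (?Q *v v))" for v
      by (simp flip: scaleR_matrix_vector_assoc)
    ultimately show ?thesis by (simp only:)
  qed
  also have "\<dots> = exp l * det ((1 / (2 * pi)) *\<^sub>R (?r\<^sup>2 *\<^sub>R ?Q)) powr (- 1/2)"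
    using r by (simp add: gaussian_integral pos_def_scaleR[OF Q])
  also have "det ((1 / (2 * pi)) *\<^sub>R (?r\<^sup>2 *\<^sub>R ?Q)) = (?r ^ CARD('d))\<^sup>2 * D"
  proof -
    have "(?r\<^sup>2) ^ CARD('d) = (?r ^ CARD('d))\<^sup>2"
      by (simp only: power_mult[symmetric] mult.commute)
    then show ?thesis by (simp only: D_def det_scaleR mult.left_commute)
  qed
  also have "\<dots> powr (- 1/2) = inverse (sqrt ((?r ^ CARD('d))\<^sup>2 * D))"
    using D by (simp add: powr_minus powr_half_sqrt)
  also have "\<dots> = inverse (sqrt D) / ?r ^ CARD('d)"
    using r by (simp add: real_sqrt_mult divide_inverse)
  also have "inverse (sqrt D) = peak_volume C s xm"
    using D by (simp add: peak_volume_def powr_minus powr_half_sqrt flip: D_def)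
  finally show ?thesis by simp
qed

theorem theorem2:
  fixes C :: "real^'n^'n"
    and s :: "real^'d \<Rightarrow> real^'n"
    and X :: "(real^'d) set"
    and a0 :: real
    and a cost :: "real^'d \<Rightarrow> real"
    and R :: "real^'d \<Rightarrow> real^'d \<Rightarrow> real"
    and m :: "real^'n"
    and xm :: "real^'d"
  assumes cov: "pos_def C"
    and dom: "open X"
    and smooth: "smooth_on s X"
    and nonzero: "\<And>x. x \<in> X \<Longrightarrow> s x \<noteq> 0"
    and a0_pos: "a0 > 0"
    and a_pos: "\<And>x. x \<in> X \<Longrightarrow> a x > 0"
    and a_int: "set_integrable lborel X a"
    and prior: "a0 + (LINT x:X|lborel. a x) = 1"
    and cost_pos: "\<And>x. x \<in> X \<Longrightarrow> cost x > 0"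
    and reward_nonneg: "\<And>x' x. x' \<in> X \<Longrightarrow> x \<in> X \<Longrightarrow> R x' x \<ge> 0"
    and reward_int: "\<And>x'. x' \<in> X \<Longrightarrow>
           set_integrable lborel X (\<lambda>x. R x' x * likelihood_ratio C s m x * a x)"
    and Q_pos_def: "\<And>x. x \<in> X \<Longrightarrow> pos_def (Q_matrix C s x)"
    and max: "is_arg_max (decision_statistic C s X a0 a cost R m) (\<lambda>x'. x' \<in> X) xm"
    and high_snr:
      "decision_statistic C s X a0 a cost R m xm =
         p0 C m / marginal C s X a0 a m *
         (a xm * (LINT x|lborel.
              exp (log_lr C s m xm
                   - (snr C s xm)\<^sup>2 / 2 * ((x - xm) \<bullet> (Q_matrix C s xm *v (x - xm)))))
          - cost xm * a0)"
  shows "bayes_test C s X a0 a cost R m xm =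
           (if log_lr C s m xm > threshold C s a0 a cost xm then Some (Signal_At xm)
            else if log_lr C s m xm < threshold C s a0 a cost xm then Some No_Signal
            else None)"
proof -
  let ?r = "snr C s xm" and ?V = "peak_volume C s xm" and ?l = "log_lr C s m xm"
  define K where "K = p0 C m / marginal C s X a0 a m"
  define H where "H = a0 * cost xm * ?r ^ CARD('d)"
  define G where "G = a xm * ?V"
  have xm: "xm \<in> X" using max by (simp add: is_arg_max_def)
  have r: "?r > 0" using cov nonzero[OF xm] by (rule snr_pos)
  have G: "G > 0" using a_pos[OF xm] peak_volume_pos[OF Q_pos_def[OF xm]] by (simp add: G_def)
  have H: "H > 0" using a0_pos cost_pos[OF xm] r by (simp add: H_def)
  have K: "K > 0"
    unfolding K_def p0_def
    by (intro divide_pos_pos gauss_density_pos marginal_pos)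
      (use cov a0_pos a_pos in \<open>auto intro: less_imp_le\<close>)
  \<comment> \<open>Factoring out the positive coefficient of \<open>exp ?l\<close> leaves the comparison of \<open>exp ?l\<close> with the
    exponential of the threshold.\<close>
  have T: "decision_statistic C s X a0 a cost R m xm
      = K * G / ?r ^ CARD('d) * (exp ?l - H / G)"
    unfolding high_snr likelihood_peak_integral[OF Q_pos_def[OF xm] r]
    using r G by (simp add: K_def[symmetric] H_def field_simps) (simp add: G_def)
  have factor: "K * G / ?r ^ CARD('d) > 0" using K G r by simp
  have threshold: "exp (threshold C s a0 a cost xm) = H / G"
    using G H by (simp add: threshold_def H_def G_def)
  have "decision_statistic C s X a0 a cost R m xm > 0 \<longleftrightarrow> ?l > threshold C s a0 a cost xm"
    unfolding T zero_less_mult_iff threshold[symmetric] using factor by simp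
  moreover have "decision_statistic C s X a0 a cost R m xm < 0 \<longleftrightarrow> ?l < threshold C s a0 a cost xm"
    unfolding T mult_less_0_iff threshold[symmetric] using factor by simp
  ultimately show ?thesis by (simp add: bayes_test_def)
qed

end
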